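(* For every real $\varepsilon>0$ there is $n_0$ such that for every integer $n\ge n_0$ and every integer $b\ge(1+\varepsilon)\frac{n}{\ln n}$, Breaker has a winning strategy in the $(2:b)$ Walker--Breaker Connectivity game played on $E(K_n)$; that is, Breaker has a strategy guaranteeing that, against any play of Walker, Walker does not claim all the edges of any spanning tree of $K_n$ by the end of the game.
   Context: The $(2:b)$ Walker--Breaker game on $E(K_n)$ (the edge set of the complete graph on $n$ vertices) is played by two players, Walker and Breaker, who alternately move, until all edges of $K_n$ are claimed. In each of his moves Breaker claims $b$ edges not yet claimed by either player (or all remaining unclaimed edges if there are fewer than $b$). Walker must choose her edges according to a walk: at her first move she chooses any vertex of $K_n$ as her starting position; each of her moves consists of two successive steps, where in one step, being positioned at a vertex $v$, she chooses an edge $vw$ not previously claimed by Breaker (it may be unclaimed or already claimed by Walker herself), claims it if it was unclaimed, and $w$ becomes her current position. Each subsequent step starts at her current position, also from one move to the next. In the Connectivity game the winning sets are the edge sets of spanning trees of $K_n$. Walker wins if by the end of the game she has claimed all edges of some winning set; otherwise Breaker wins. Convention for this result: Breaker's strategy is required to work even if Walker is the first player; the game is taken with Walker making the first move. *)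

theory Defs
  imports Complex_Main "HOL-Library.Ramsey"
begin

section \<open>Spanning trees\<close>

text \<open>
  Finite simple graphs are given by a vertex set \<open>V\<close> and a set of edges
  \<open>E \<subseteq> nsets V 2\<close>, so that \<open>nsets V 2\<close> is the edge set of the complete graph on \<open>V\<close>.
\<close>

definition connected_graph :: "'a set \<Rightarrow> 'a set set \<Rightarrow> bool" where
  "connected_graph V E \<longleftrightarrow> (\<forall>u\<in>V. \<forall>v\<in>V. (u, v) \<in> {(x, y). {x, y} \<in> E}\<^sup>*)"

definition graph_cycle :: "'a set set \<Rightarrow> 'a list \<Rightarrow> bool" where
  "graph_cycle E c \<longleftrightarrow> 3 \<le> length c \<and> distinct c \<and>
     (\<forall>i < length c. {c ! i, c ! (Suc i mod length c)} \<in> E)"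

definition spanning_tree :: "'a set \<Rightarrow> 'a set set \<Rightarrow> bool" where
  "spanning_tree V T \<longleftrightarrow> T \<subseteq> nsets V 2 \<and> connected_graph V T \<and> (\<nexists>c. graph_cycle T c)"

section \<open>The (2:b) Walker--Breaker game on the complete graph with vertex set \<open>{..<n}\<close>\<close>

definition complete_edges :: "nat \<Rightarrow> nat set set" where
  "complete_edges n = nsets {..<n} 2"

text \<open>
  A history of the game is a pair \<open>(p, Bs)\<close>: the nonempty list \<open>p\<close> of the vertices visited by
  Walker so far (starting position first, current position last), and the list \<open>Bs\<close> of the edge
  sets claimed by Breaker in his successive moves. Every edge traversed by Walker is claimed by
  her, at its first traversal, so her edges are exactly those of the walk \<open>p\<close>.
\<close>

definition walker_edges :: "nat list \<Rightarrow> nat set set" where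
  "walker_edges p = {{p ! i, p ! Suc i} | i. Suc i < length p}"

definition breaker_edges :: "nat set set list \<Rightarrow> nat set set" where
  "breaker_edges Bs = \<Union> (set Bs)"

definition unclaimed :: "nat \<Rightarrow> nat list \<Rightarrow> nat set set list \<Rightarrow> nat set set" where
  "unclaimed n p Bs = complete_edges n - (walker_edges p \<union> breaker_edges Bs)"

definition walker_step :: "nat \<Rightarrow> nat list \<Rightarrow> nat set set list \<Rightarrow> nat \<Rightarrow> bool" where
  "walker_step n p Bs w \<longleftrightarrow> {last p, w} \<in> complete_edges n - breaker_edges Bs"

definition legal_breaker_move ::
    "nat \<Rightarrow> nat \<Rightarrow> nat list \<Rightarrow> nat set set list \<Rightarrow> nat set set \<Rightarrow> bool" where
  "legal_breaker_move n b p Bs S \<longleftrightarrow>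
     S \<subseteq> unclaimed n p Bs \<and> card S = min b (card (unclaimed n p Bs))"

text \<open>A (deterministic) strategy of Breaker may use the full history.\<close>

type_synonym breaker_strategy = "nat list \<Rightarrow> nat set set list \<Rightarrow> nat set set"

datatype player = Walker | Breaker

text \<open>
  \<open>reachable n \<sigma> P p Bs\<close>: the history \<open>(p, Bs)\<close>, with player \<open>P\<close> to move next unless all edges are
  claimed, can arise when Walker makes the first move, Walker plays arbitrarily within the rules
  and Breaker follows \<open>\<sigma>\<close>. If the last edge is claimed in the first step of a move of Walker, the
  second step is immaterial: she can always walk back along her own edge, and nothing is left to
  be claimed.
\<close>

inductive reachable ::
    "nat \<Rightarrow> breaker_strategy \<Rightarrow> player \<Rightarrow> nat list \<Rightarrow> nat set set list \<Rightarrow> bool"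
  for n :: nat and \<sigma> :: breaker_strategy where
  start: "v < n \<Longrightarrow> reachable n \<sigma> Walker [v] []"
| walker_move: "reachable n \<sigma> Walker p Bs \<Longrightarrow> unclaimed n p Bs \<noteq> {} \<Longrightarrow>
     walker_step n p Bs u \<Longrightarrow> walker_step n (p @ [u]) Bs w \<Longrightarrow>
     reachable n \<sigma> Breaker (p @ [u, w]) Bs"
| breaker_move: "reachable n \<sigma> Breaker p Bs \<Longrightarrow> unclaimed n p Bs \<noteq> {} \<Longrightarrow>
     reachable n \<sigma> Walker p (Bs @ [\<sigma> p Bs])"

definition walker_has_won :: "nat set set set \<Rightarrow> nat list \<Rightarrow> bool" where
  "walker_has_won \<F> p \<longleftrightarrow> (\<exists>F\<in>\<F>. F \<subseteq> walker_edges p)"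

text \<open>
  A winning strategy of Breaker for the family \<open>\<F>\<close> of winning sets always prescribes a legal move,
  and Walker has claimed no winning set at the end of the game, i.e. once no edge is unclaimed.
  For \<open>b \<ge> 1\<close> every play consistent with such a strategy ends, since each move of Breaker claims
  at least one further edge.
\<close>

definition breaker_winning_strategy ::
    "nat \<Rightarrow> nat \<Rightarrow> nat set set set \<Rightarrow> breaker_strategy \<Rightarrow> bool" where
  "breaker_winning_strategy n b \<F> \<sigma> \<longleftrightarrow>
     (\<forall>p Bs. reachable n \<sigma> Breaker p Bs \<longrightarrow> unclaimed n p Bs \<noteq> {} \<longrightarrow>
        legal_breaker_move n b p Bs (\<sigma> p Bs)) \<and>
     (\<forall>P p Bs. reachable n \<sigma> P p Bs \<longrightarrow> unclaimed n p Bs = {} \<longrightarrow> \<not> walker_has_won \<F> p)"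

definition connectivity_winning_sets :: "nat \<Rightarrow> nat set set set" where
  "connectivity_winning_sets n = {T. spanning_tree {..<n} T}"

end

theory Submission
  imports Defs "HOL-Analysis.Harmonic_Numbers" "HOL-Real_Asymp.Real_Asymp"
begin

text \<open>
  Breaker wins by keeping Walker away from some vertex altogether: a vertex that the walk never
  visits is isolated in Walker's graph. As in the argument of Chvatal and Erdos for the
  ordinary Maker--Breaker game, Breaker first builds a clique of his own on unvisited vertices and
  then claims all the other edges at one of its vertices, by playing a box game.

  Being confined to a walk is what costs Walker the factor two that her two steps per move would
  otherwise be worth. The edges inside Breaker's clique are barred to her, so she never visits two
  of its vertices in two consecutive steps, and each of her moves spoils at most one of
  them (\<open>boxes_walker_move\<close>).

  While the clique is small, Breaker can add two unvisited vertices to it in every move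
  (\<open>boxes_grow\<close>), so that it gains at least one vertex per round. A clique of
  \<open>k \<approx> n / (ln n)\<^sup>2\<close> vertices is thus reached after \<open>k\<close> rounds, while only about \<open>2 k\<close>
  vertices have been visited and while \<open>2 k \<le> b\<close>. From then on, each clique vertex is a box holding
  the fewer than \<open>n\<close> unclaimed edges at it. When \<open>m\<close> boxes are left, Breaker removes
  \<open>b div m\<close> edges from each of them (\<open>boxes_deplete\<close>), and then Walker spoils one box. The last box is
  emptied if \<open>\<Sum>j=1..<k. b div j \<ge> n\<close>. This sum is at least \<open>b * ln k - k\<close>, and \<open>ln k\<close> is
  asymptotic to \<open>ln n\<close>, so \<open>b \<ge> (1 + \<epsilon>) * n / ln n\<close> is enough (\<open>box_parameters\<close>).

  Both phases are described by a single invariant of the position, from which a strategy is read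
  off by choice (\<open>winning_strategy_of_invariant\<close>).
\<close>

section \<open>Unvisited vertices and invariants\<close>

lemma walker_edges_subset: "e \<in> walker_edges p \<Longrightarrow> e \<subseteq> set p"
  by (auto simp: walker_edges_def)

lemma doubleton_in_complete_edges_iff:
  "{x, y} \<in> complete_edges n \<longleftrightarrow> x < n \<and> y < n \<and> x \<noteq> y"
  by (auto simp: complete_edges_def nsets_def card_insert_if)

lemma finite_unclaimed: "finite (unclaimed n p Bs)"
  by (simp add: unclaimed_def complete_edges_def finite_imp_finite_nsets)

lemma breaker_edges_append: "breaker_edges (Bs @ [S]) = breaker_edges Bs \<union> S"
  by (auto simp: breaker_edges_def)

lemma walker_has_not_won_if_unvisited:
  assumes "2 \<le> n" "v < n" "v \<notin> set p"
  shows "\<not> walker_has_won (connectivity_winning_sets n) p"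
proof
  assume "walker_has_won (connectivity_winning_sets n) p"
  then obtain T where conn: "connected_graph {..<n} T" and T: "T \<subseteq> walker_edges p"
    by (auto simp: walker_has_won_def connectivity_winning_sets_def spanning_tree_def)
  obtain u where u: "u < n" "u \<noteq> v"
    using assms(1) by (metis less_2_cases_iff less_le_trans one_less_numeral_iff pos2 semiring_norm(76) zero_neq_one)
  have "(v, u) \<in> {(x, y). {x, y} \<in> T}\<^sup>*"
    using conn u assms(2) by (auto simp: connected_graph_def)
  then obtain y where "{v, y} \<in> T"
    using u by (auto elim: converse_rtranclE)
  with T walker_edges_subset assms(3) show False by blast
qed

lemma winning_strategy_of_invariant:
  fixes W B :: "nat list \<Rightarrow> nat set set \<Rightarrow> bool"
  assumes init: "\<And>v. v < n \<Longrightarrow> W [v] {}"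
    and walker: "\<And>p Bs u w. W p (breaker_edges Bs) \<Longrightarrow> walker_step n p Bs u
        \<Longrightarrow> walker_step n (p @ [u]) Bs w \<Longrightarrow> B (p @ [u, w]) (breaker_edges Bs)"
    and breaker: "\<And>p Bs. B p (breaker_edges Bs) \<Longrightarrow>
        \<exists>S \<subseteq> unclaimed n p Bs. card S \<le> b \<and> W p (breaker_edges Bs \<union> S)"
    and mono: "\<And>p E E'. W p E \<Longrightarrow> E \<subseteq> E' \<Longrightarrow> W p E'"
    and final: "\<And>p E. W p E \<or> B p E \<Longrightarrow> \<not> walker_has_won \<F> p"
  shows "\<exists>\<sigma>. breaker_winning_strategy n b \<F> \<sigma>"
proof -
  define good where
    "good p Bs S \<longleftrightarrow> legal_breaker_move n b p Bs S \<and> W p (breaker_edges (Bs @ [S]))" for p Bs S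
  define \<sigma> where "\<sigma> p Bs = (SOME S. good p Bs S)" for p Bs
  have good: "good p Bs (\<sigma> p Bs)" if B: "B p (breaker_edges Bs)" for p Bs
  proof -
    obtain S where S: "S \<subseteq> unclaimed n p Bs" "card S \<le> b" "W p (breaker_edges Bs \<union> S)"
      using breaker[OF B] by blast
    \<comment> \<open>A legal move has a prescribed size, so the set is padded with arbitrary unclaimed edges.\<close>
    have "card S \<le> min b (card (unclaimed n p Bs))"
      using S card_mono[OF finite_unclaimed S(1)] by simp
    then obtain S' where "S \<subseteq> S'" "S' \<subseteq> unclaimed n p Bs" "card S' = min b (card (unclaimed n p Bs))"
      using exists_subset_between[of S "min b (card (unclaimed n p Bs))" "unclaimed n p Bs"]
        S(1) finite_unclaimed by auto
    moreover have "W p (breaker_edges Bs \<union> S')"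
      using mono[OF S(3)] \<open>S \<subseteq> S'\<close> by blast
    ultimately have "good p Bs S'"
      by (auto simp: good_def legal_breaker_move_def breaker_edges_append)
    then show ?thesis
      unfolding \<sigma>_def by (rule someI)
  qed
  have inv: "if P = Walker then W p (breaker_edges Bs) else B p (breaker_edges Bs)"
    if "reachable n \<sigma> P p Bs" for P p Bs
    using that
  proof induction
    case (start v)
    then show ?case by (simp add: init breaker_edges_def)
  next
    case (walker_move p Bs u w)
    then show ?case by (simp add: walker)
  next
    case (breaker_move p Bs)
    then show ?case using good[of p Bs] by (simp add: good_def)
  qed
  have "breaker_winning_strategy n b \<F> \<sigma>"
    unfolding breaker_winning_strategy_def
  proof (intro conjI allI impI)
    fix p Bs assume "reachable n \<sigma> Breaker p Bs"
    then show "legal_breaker_move n b p Bs (\<sigma> p Bs)"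
      using inv good by (fastforce simp: good_def)
  next
    fix P p Bs assume "reachable n \<sigma> P p Bs"
    then show "\<not> walker_has_won \<F> p"
      using inv final by (metis (full_types))
  qed
  then show ?thesis by blast
qed

section \<open>Boxes\<close>

definition open_neighbours :: "nat \<Rightarrow> nat set set \<Rightarrow> nat \<Rightarrow> nat set" where
  "open_neighbours n E c = {y. y < n \<and> y \<noteq> c \<and> {c, y} \<notin> E}"

text \<open>
  The set \<open>C\<close> is the clique of Breaker, and the edges from \<open>c \<in> C\<close> to its open neighbours form
  the box of \<open>c\<close>, so \<open>s\<close> bounds the contents of each of the \<open>m\<close> boxes. While the clique is being
  built, \<open>s = n\<close> makes this bound vacuous.
\<close>

definition boxes :: "nat \<Rightarrow> nat list \<Rightarrow> nat set set \<Rightarrow> nat \<Rightarrow> nat \<Rightarrow> bool" where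
  "boxes n p E m s \<longleftrightarrow> (\<exists>C \<subseteq> {..<n} - set p. card C = m \<and>
     nsets C 2 \<subseteq> E \<and> (\<forall>c\<in>C. card (open_neighbours n E c) \<le> s))"

lemma finite_open_neighbours: "finite (open_neighbours n E c)"
  by (simp add: open_neighbours_def)

lemma card_open_neighbours_le: "card (open_neighbours n E c) \<le> n"
proof -
  have "open_neighbours n E c \<subseteq> {..<n}"
    by (auto simp: open_neighbours_def)
  then show ?thesis
    by (metis card_lessThan card_mono finite_lessThan)
qed

lemma boxes_0: "boxes n p E 0 s"
  unfolding boxes_def by (rule exI[of _ "{}"]) (auto simp: nsets_def)

lemma boxes_mono:
  assumes "boxes n p E m s" "E \<subseteq> E'" "m' \<le> m" "s \<le> s'"
  shows "boxes n p E' m' s'"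
proof -
  obtain C where C: "C \<subseteq> {..<n} - set p" "card C = m" "nsets C 2 \<subseteq> E"
    "\<forall>c\<in>C. card (open_neighbours n E c) \<le> s"
    using assms(1) by (auto simp: boxes_def)
  obtain D where D: "D \<subseteq> C" "card D = m'"
    using C(2) assms(3) obtain_subset_with_card_n by metis
  have "card (open_neighbours n E' c) \<le> s'" if "c \<in> D" for c
  proof -
    have "open_neighbours n E' c \<subseteq> open_neighbours n E c"
      using assms(2) by (auto simp: open_neighbours_def)
    then have "card (open_neighbours n E' c) \<le> card (open_neighbours n E c)"
      by (simp add: card_mono finite_open_neighbours)
    also have "\<dots> \<le> s'" using C(4) D(1) assms(4) that by fastforce
    finally show ?thesis .
  qed
  moreover have "nsets D 2 \<subseteq> E'"
    using nsets_mono[OF D(1)] C(3) assms(2) by blast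
  ultimately show ?thesis
    using C(1) D unfolding boxes_def by blast
qed

lemma boxes_unvisited:
  assumes "boxes n p E m s" "1 \<le> m"
  shows "\<exists>v<n. v \<notin> set p"
proof -
  obtain C where "C \<subseteq> {..<n} - set p" "card C = m"
    using assms(1) by (auto simp: boxes_def)
  moreover from this have "C \<noteq> {}" using assms(2) by auto
  ultimately show ?thesis by blast
qed

lemma walker_two_steps:
  assumes "walker_step n p Bs u" "walker_step n (p @ [u]) Bs w"
  shows "last p < n" "u < n" "w < n" "last p \<noteq> u" "u \<noteq> w"
    "{last p, u} \<notin> breaker_edges Bs" "{u, w} \<notin> breaker_edges Bs"
  using assms by (auto simp: walker_step_def doubleton_in_complete_edges_iff)

text \<open>
  The two vertices reached in a move are joined by an edge that Breaker does not own, so they do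
  not both lie in his clique.
\<close>

lemma boxes_walker_move:
  assumes "boxes n p (breaker_edges Bs) m s"
    and "walker_step n p Bs u" "walker_step n (p @ [u]) Bs w"
  shows "boxes n (p @ [u, w]) (breaker_edges Bs) (m - 1) s"
proof -
  let ?E = "breaker_edges Bs"
  obtain C where C: "C \<subseteq> {..<n} - set p" "card C = m" "nsets C 2 \<subseteq> ?E"
    "\<forall>c\<in>C. card (open_neighbours n ?E c) \<le> s"
    using assms(1) by (auto simp: boxes_def)
  note step = walker_two_steps[OF assms(2,3)]
  have "\<not> (u \<in> C \<and> w \<in> C)"
  proof
    assume "u \<in> C \<and> w \<in> C"
    then have "{u, w} \<in> nsets C 2"
      using step(5) by (auto simp: nsets_def)
    with C(3) step(7) show False by blast
  qed
  then obtain z where z: "C \<inter> {u, w} \<subseteq> {z}" by blast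
  have "finite C" using C(1) finite_subset by blast
  have "m - 1 \<le> card (C - {z})"
    using C(2) \<open>finite C\<close> by (simp add: card_Diff_singleton_if)
  also have "\<dots> \<le> card (C - {u, w})"
    using z \<open>finite C\<close> by (intro card_mono) auto
  finally have card: "m - 1 \<le> card (C - {u, w})" .
  have "boxes n (p @ [u, w]) ?E (card (C - {u, w})) s"
    unfolding boxes_def
    using C nsets_mono[of "C - {u, w}" C 2] by (intro exI[of _ "C - {u, w}"]) auto
  then show ?thesis
    using card boxes_mono by blast
qed

text \<open>Walker cannot enter an empty box, hence Breaker may hold such a box until the end of the game.\<close>

lemma boxes_walker_move_empty:
  assumes "boxes n p (breaker_edges Bs) m 0"
    and "walker_step n p Bs u" "walker_step n (p @ [u]) Bs w"
  shows "boxes n (p @ [u, w]) (breaker_edges Bs) m 0"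
proof -
  let ?E = "breaker_edges Bs"
  obtain C where C: "C \<subseteq> {..<n} - set p" "card C = m" "nsets C 2 \<subseteq> ?E"
    "\<forall>c\<in>C. card (open_neighbours n ?E c) \<le> 0"
    using assms(1) by (auto simp: boxes_def)
  note step = walker_two_steps[OF assms(2,3)]
  have closed: "{c, y} \<in> ?E" if "c \<in> C" "y < n" "y \<noteq> c" for c y
    using C(4) that by (auto simp: open_neighbours_def)
  have "u \<notin> C" "w \<notin> C"
    using closed[of u "last p"] closed[of w u] step by (auto simp: insert_commute)
  then show ?thesis
    using C unfolding boxes_def by (intro exI[of _ C]) auto
qed

section \<open>Moves of Breaker\<close>

text \<open>
  The edges claimed are those of the enlarged clique that have an end \<open>x\<close> or \<open>y\<close> among the two new
  vertices. Walker owns none of them, since both of their ends are unvisited.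
\<close>

lemma boxes_grow:
  assumes "boxes n p (breaker_edges Bs) m s"
    and unvisited: "m + 2 \<le> card ({..<n} - set p)" and b: "2 * (m + 2) \<le> b"
  shows "\<exists>S \<subseteq> unclaimed n p Bs. card S \<le> b \<and> boxes n p (breaker_edges Bs \<union> S) (m + 2) n"
proof -
  let ?E = "breaker_edges Bs"
  obtain C where C: "C \<subseteq> {..<n} - set p" "card C = m" "nsets C 2 \<subseteq> ?E"
    using assms(1) by (auto simp: boxes_def)
  obtain D where D: "C \<subseteq> D" "D \<subseteq> {..<n} - set p" "card D = m + 2"
    using exists_subset_between[of C "m + 2" "{..<n} - set p"] C unvisited by auto
  have fin: "finite D" using D(2) finite_subset by blast
  have "card (D - C) = 2"
    using C(2) D fin by (simp add: card_Diff_subset finite_subset)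
  then obtain x y where xy: "D - C = {x, y}"
    by (meson card_2_iff)
  define S where "S = nsets D 2 - ?E"
  have "nsets D 2 \<subseteq> complete_edges n"
    unfolding complete_edges_def using D(2) by (intro nsets_mono) auto
  moreover have "e \<notin> walker_edges p" if "e \<in> nsets D 2" for e
    using that D(2) walker_edges_subset[of e p] by (fastforce simp: nsets_def card_2_iff)
  ultimately have "S \<subseteq> unclaimed n p Bs"
    unfolding S_def unclaimed_def by blast
  moreover have "card S \<le> b"
  proof -
    have "S \<subseteq> (\<lambda>d. {x, d}) ` D \<union> (\<lambda>d. {y, d}) ` D"
    proof
      fix e assume e: "e \<in> S"
      then obtain a d where ad: "e = {a, d}" "a \<in> D" "d \<in> D"
        by (auto simp: S_def nsets_def card_2_iff)
      from e C(3) have "\<not> e \<subseteq> C"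
        by (auto simp: S_def nsets_def)
      with ad xy show "e \<in> (\<lambda>d. {x, d}) ` D \<union> (\<lambda>d. {y, d}) ` D"
        by (auto simp: insert_commute)
    qed
    then have "card S \<le> card ((\<lambda>d. {x, d}) ` D \<union> (\<lambda>d. {y, d}) ` D)"
      using fin by (intro card_mono) auto
    also have "\<dots> \<le> card D + card D"
      by (meson add_mono card_Un_le card_image_le fin le_trans)
    finally show ?thesis using D(3) b by simp
  qed
  moreover have "boxes n p (?E \<union> S) (m + 2) n"
    unfolding boxes_def using D card_open_neighbours_le
    by (intro exI[of _ D]) (auto simp: S_def)
  ultimately show ?thesis by blast
qed

lemma boxes_deplete:
  assumes "boxes n p (breaker_edges Bs) m s" and b: "m * q \<le> b"
  shows "\<exists>S \<subseteq> unclaimed n p Bs. card S \<le> b \<and> boxes n p (breaker_edges Bs \<union> S) m (s - q)"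
proof -
  let ?E = "breaker_edges Bs"
  obtain C where C: "C \<subseteq> {..<n} - set p" "card C = m" "nsets C 2 \<subseteq> ?E"
    "\<forall>c\<in>C. card (open_neighbours n ?E c) \<le> s"
    using assms(1) by (auto simp: boxes_def)
  have fin: "finite C" using C(1) finite_subset by blast
  have "\<forall>c. \<exists>Y \<subseteq> open_neighbours n ?E c. card Y = min q (card (open_neighbours n ?E c))"
    by (metis min.cobounded2 obtain_subset_with_card_n)
  then obtain Y where Y: "\<And>c. Y c \<subseteq> open_neighbours n ?E c"
      "\<And>c. card (Y c) = min q (card (open_neighbours n ?E c))"
    by metis
  have finY: "finite (Y c)" for c
    using Y(1) finite_open_neighbours finite_subset by blast
  define S where "S = (\<Union>c\<in>C. (\<lambda>y. {c, y}) ` Y c)"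
  have "S \<subseteq> unclaimed n p Bs"
  proof
    fix e assume "e \<in> S"
    then obtain c y where cy: "e = {c, y}" "c \<in> C" "y \<in> Y c"
      by (auto simp: S_def)
    then have "y < n" "y \<noteq> c" "{c, y} \<notin> ?E" "c < n" "c \<notin> set p"
      using Y(1)[of c] C(1) by (auto simp: open_neighbours_def)
    then show "e \<in> unclaimed n p Bs"
      using walker_edges_subset[of "{c, y}" p]
      by (auto simp: unclaimed_def cy doubleton_in_complete_edges_iff)
  qed
  moreover have "card S \<le> b"
  proof -
    have "card S \<le> (\<Sum>c\<in>C. card ((\<lambda>y. {c, y}) ` Y c))"
      unfolding S_def by (rule card_UN_le[OF fin])
    also have "\<dots> \<le> (\<Sum>c\<in>C. q)"
      by (intro sum_mono order.trans[OF card_image_le[OF finY]]) (simp add: Y(2))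
    finally show ?thesis using C(2) b by simp
  qed
  moreover have "boxes n p (?E \<union> S) m (s - q)"
  proof -
    have "card (open_neighbours n (?E \<union> S) c) \<le> s - q" if c: "c \<in> C" for c
    proof -
      have "open_neighbours n (?E \<union> S) c \<subseteq> open_neighbours n ?E c - Y c"
        using c by (auto simp: open_neighbours_def S_def)
      then have "card (open_neighbours n (?E \<union> S) c) \<le> card (open_neighbours n ?E c - Y c)"
        by (simp add: card_mono finite_open_neighbours)
      also have "\<dots> = card (open_neighbours n ?E c) - card (Y c)"
        by (rule card_Diff_subset[OF finY Y(1)])
      also have "\<dots> \<le> s - q"
        using C(4) c Y(2)[of c] by fastforce
      finally show ?thesis .
    qed
    then show ?thesis
      using C unfolding boxes_def by (intro exI[of _ C]) auto
  qed
  ultimately show ?thesis by blast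
qed

section \<open>Winning with suitable parameters\<close>

lemma breaker_wins_if_parameters:
  fixes n b k :: nat
  assumes k: "2 \<le> k" "2 * k \<le> b" "3 * k + 2 \<le> n" and sum: "n \<le> (\<Sum>j=1..<k. b div j)"
  shows "\<exists>\<sigma>. breaker_winning_strategy n b (connectivity_winning_sets n) \<sigma>"
proof -
  \<comment> \<open>the contents of each box when \<open>m\<close> boxes are left and Walker is to move\<close>
  define s where "s m = n - (\<Sum>j=m..<k. b div j)" for m
  have s_k: "s k = n" and s_1: "s 1 = 0" using sum by (auto simp: s_def)
  have s_step: "s (Suc m) - b div m = s m" if "m < k" for m
    using that by (simp add: s_def sum.atLeast_Suc_lessThan)
  \<comment> \<open>Only the clique-building phase refers to the length of the walk, to ensure that enough
    unvisited vertices are left.\<close>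
  define W where "W p E \<longleftrightarrow>
    (\<exists>t<k. length p = 2 * t + 1 \<and> boxes n p E t n) \<or> (\<exists>m. 1 \<le> m \<and> m \<le> k \<and> boxes n p E m (s m))" for p E
  define B where "B p E \<longleftrightarrow>
    (\<exists>t<k. length p = 2 * t + 3 \<and> boxes n p E (t - 1) n) \<or>
    (\<exists>m. 1 \<le> m \<and> m < k \<and> boxes n p E m (s (Suc m))) \<or> boxes n p E 1 0" for p E
  have unvisited: "n - length p \<le> card ({..<n} - set p)" for p :: "nat list"
  proof -
    have "n - length p \<le> n - card (set p)" using card_length[of p] by linarith
    also have "\<dots> \<le> card ({..<n} - set p)"
      using diff_card_le_card_Diff[of "set p" "{..<n}"] by simp
    finally show ?thesis .
  qed
  show ?thesis
  proof (rule winning_strategy_of_invariant[where W = W and B = B])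
    fix v :: nat
    show "W [v] {}"
      using k by (auto simp: W_def boxes_0 intro!: exI[of _ 0])
  next
    fix p Bs u w
    assume W: "W p (breaker_edges Bs)"
      and steps: "walker_step n p Bs u" "walker_step n (p @ [u]) Bs w"
    from W consider (build) t where "t < k" "length p = 2 * t + 1" "boxes n p (breaker_edges Bs) t n"
      | (last) "boxes n p (breaker_edges Bs) 1 0"
      | (box) m where "2 \<le> m" "m \<le> k" "boxes n p (breaker_edges Bs) m (s m)"
      unfolding W_def using s_1
      by (metis One_nat_def Suc_1 Suc_leI le_neq_implies_less)
    then show "B (p @ [u, w]) (breaker_edges Bs)"
    proof cases
      case build
      then show ?thesis
        using boxes_walker_move[OF build(3) steps] by (auto simp: B_def)
    next
      case last
      then show ?thesis
        using boxes_walker_move_empty[OF last steps] by (auto simp: B_def)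
    next
      case box
      then have "1 \<le> m - 1" "m - 1 < k" "Suc (m - 1) = m" by auto
      then show ?thesis
        using boxes_walker_move[OF box(3) steps] unfolding B_def by metis
    qed
  next
    fix p Bs
    assume "B p (breaker_edges Bs)"
    then consider (build) t where "t < k" "length p = 2 * t + 3" "boxes n p (breaker_edges Bs) (t - 1) n"
      | (box) m where "1 \<le> m" "m < k" "boxes n p (breaker_edges Bs) m (s (Suc m))"
      | (last) "boxes n p (breaker_edges Bs) 1 0"
      unfolding B_def by blast
    then show "\<exists>S \<subseteq> unclaimed n p Bs. card S \<le> b \<and> W p (breaker_edges Bs \<union> S)"
    proof cases
      case build
      have "t - 1 + 2 \<le> card ({..<n} - set p)"
        using build(1,2) k unvisited[of p] by linarith
      moreover have "t - 1 + 2 \<le> k"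
        using build(1) k(1) by (cases t) auto
      then have "2 * (t - 1 + 2) \<le> b"
        using k(2) mult_le_mono2 order.trans by blast
      ultimately obtain S where S: "S \<subseteq> unclaimed n p Bs" "card S \<le> b"
        "boxes n p (breaker_edges Bs \<union> S) (t - 1 + 2) n"
        using boxes_grow[OF build(3)] by blast
      have grown: "boxes n p (breaker_edges Bs \<union> S) (Suc t) n"
        using boxes_mono[OF S(3)] by simp
      have "W p (breaker_edges Bs \<union> S)"
      proof (cases "Suc t = k")
        case True
        then show ?thesis using grown s_k k by (auto simp: W_def)
      next
        case False
        then show ?thesis using grown build(1,2) by (auto simp: W_def intro!: exI[of _ "Suc t"])
      qed
      with S show ?thesis by blast
    next
      case box
      obtain S where S: "S \<subseteq> unclaimed n p Bs" "card S \<le> b"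
        "boxes n p (breaker_edges Bs \<union> S) m (s (Suc m) - b div m)"
        using boxes_deplete[OF box(3), of "b div m" b] by auto
      then show ?thesis
        using s_step[OF box(2)] box unfolding W_def by auto
    next
      case last
      then have "W p (breaker_edges Bs \<union> {})"
        using k s_1 unfolding W_def by (intro disjI2 exI[of _ 1]) auto
      then show ?thesis by (metis card.empty empty_subsetI zero_le)
    qed
  next
    fix p E E'
    assume "W p E" "E \<subseteq> E'"
    then show "W p E'" unfolding W_def using boxes_mono by blast
  next
    fix p E
    assume "W p E \<or> B p E"
    then have "length p < n \<or> (\<exists>m s. 1 \<le> m \<and> boxes n p E m s)"
      using k unfolding W_def B_def by fastforce
    then obtain v where "v < n" "v \<notin> set p"
    proof
      assume "length p < n"
      then have "card ({..<n} - set p) > 0" using unvisited[of p] by linarith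
      then have "{..<n} - set p \<noteq> {}" by (metis card.empty less_irrefl)
      then show ?thesis using that by blast
    qed (use boxes_unvisited that in blast)
    then show "\<not> walker_has_won (connectivity_winning_sets n) p"
      using walker_has_not_won_if_unvisited k by simp
  qed
qed

section \<open>The choice of the clique size\<close>

lemma sum_div_ge:
  fixes b k :: nat
  assumes "1 \<le> k"
  shows "real b * ln (real k) - real k \<le> real (\<Sum>j=1..<k. b div j)"
proof -
  have k: "{1..<k} = {1..k - 1}" using assms by auto
  have "ln (real k) \<le> harm (k - 1)"
    using ln_le_harm[of "k - 1"] assms by (simp add: of_nat_diff)
  then have "real b * ln (real k) - real k \<le> real b * harm (k - 1) - real (k - 1)"
    by (intro diff_mono mult_left_mono) auto
  also have "\<dots> = (\<Sum>j=1..<k. real b / real j - 1)"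
    unfolding k by (simp add: harm_def sum_subtractf sum_distrib_left divide_inverse)
  also have "\<dots> \<le> (\<Sum>j=1..<k. real (b div j))"
  proof (rule sum_mono)
    fix j
    show "real b / real j - 1 \<le> real (b div j)"
      using real_of_int_div3[of "int b" "int j"] by (simp flip: of_nat_div)
  qed
  finally show ?thesis by simp
qed

text \<open>
  The clique must be large enough that \<open>ln k\<close> is close to \<open>ln n\<close>, and \<open>k\<close> must be small compared
  with \<open>n / ln n\<close>, so that the loss \<open>k\<close> from rounding in the box game is negligible.
\<close>

lemma box_parameters:
  fixes \<epsilon> :: real
  assumes "\<epsilon> > 0"
  shows "\<forall>\<^sub>F n in sequentially. \<forall>b::nat. real b \<ge> (1 + \<epsilon>) * (real n / ln (real n)) \<longrightarrow>
    (\<exists>k. 2 \<le> k \<and> 2 * k \<le> b \<and> 3 * k + 2 \<le> n \<and> n \<le> (\<Sum>j=1..<k. b div j))"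
proof -
  define x where "x n = real n / (ln (real n))\<^sup>2" for n :: nat
  have x1: "\<forall>\<^sub>F n in sequentially. x n \<ge> 1"
    unfolding x_def by real_asymp
  have x2: "\<forall>\<^sub>F n in sequentially. 2 * (x n + 1) \<le> (1 + \<epsilon>) * (real n / ln (real n))"
    unfolding x_def using assms by real_asymp
  have x3: "\<forall>\<^sub>F n in sequentially. 3 * (x n + 1) + 2 \<le> real n"
    unfolding x_def by real_asymp
  have x4: "\<forall>\<^sub>F n in sequentially.
      real n \<le> (1 + \<epsilon>) * (real n / ln (real n)) * ln (x n) - (x n + 1)"
    unfolding x_def using assms by real_asymp
  show ?thesis
    using x1 x2 x3 x4
  proof eventually_elim
    case (elim n)
    show ?case
    proof (intro allI impI)
      fix b :: nat
      assume b: "real b \<ge> (1 + \<epsilon>) * (real n / ln (real n))"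
      define k where "k = Suc (nat \<lfloor>x n\<rfloor>)"
      have k_ge: "x n \<le> real k" and k_le: "real k \<le> x n + 1"
        using elim(1) unfolding k_def by linarith+
      have "2 \<le> k"
        using elim(1) unfolding k_def by (simp add: le_nat_iff)
      moreover have "2 * k \<le> b"
      proof -
        have "real (2 * k) \<le> real b" using elim(2) k_le b by simp
        then show ?thesis by (simp only: of_nat_le_iff)
      qed
      moreover have "3 * k + 2 \<le> n"
      proof -
        have "real (3 * k + 2) \<le> real n" using elim(3) k_le by simp
        then show ?thesis by (simp only: of_nat_le_iff)
      qed
      moreover have "n \<le> (\<Sum>j=1..<k. b div j)"
      proof -
        have "real n \<le> (1 + \<epsilon>) * (real n / ln (real n)) * ln (x n) - (x n + 1)"
          by (rule elim(4))
        also have "\<dots> \<le> real b * ln (real k) - real k"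
          using b k_ge k_le elim(1) by (intro diff_mono mult_mono) auto
        also have "\<dots> \<le> real (\<Sum>j=1..<k. b div j)"
          using \<open>2 \<le> k\<close> by (intro sum_div_ge) simp
        finally show ?thesis by (simp only: of_nat_le_iff)
      qed
      ultimately show "\<exists>k. 2 \<le> k \<and> 2 * k \<le> b \<and> 3 * k + 2 \<le> n \<and> n \<le> (\<Sum>j=1..<k. b div j)"
        by blast
    qed
  qed
qed

theorem theorem1p4:
  fixes \<epsilon> :: real
  assumes "\<epsilon> > 0"
  shows "\<exists>n\<^sub>0::nat. \<forall>n\<ge>n\<^sub>0. \<forall>b::nat. real b \<ge> (1 + \<epsilon>) * (real n / ln (real n)) \<longrightarrow>
    (\<exists>\<sigma>. breaker_winning_strategy n b (connectivity_winning_sets n) \<sigma>)"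
proof -
  obtain n\<^sub>0 :: nat where "\<forall>n\<ge>n\<^sub>0. \<forall>b::nat. real b \<ge> (1 + \<epsilon>) * (real n / ln (real n)) \<longrightarrow>
    (\<exists>k. 2 \<le> k \<and> 2 * k \<le> b \<and> 3 * k + 2 \<le> n \<and> n \<le> (\<Sum>j=1..<k. b div j))"
    using box_parameters[OF assms] unfolding eventually_sequentially by blast
  then show ?thesis
    using breaker_wins_if_parameters by blast
qed

end
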